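(* Let $n\ge 3$ be an integer. Let $\mathbb{X}$ be a $3$-dimensional real polyhedral Banach space (that is, $\mathbb{R}^3$ with a norm) such that $B_{\mathbb{X}}$ is the polyhedron with vertices $$\Bigl(\cos\tfrac{(j-1)\pi}{n},\ \sin\tfrac{(j-1)\pi}{n},\ \pm 1\Bigr),\quad j\in\{1,2,\ldots,2n\},\qquad\text{and}\qquad (0,0,\pm 2).$$ Then $n(\mathbb{X})=\sin\frac{\pi}{2n}$ when $n$ is odd, and $n(\mathbb{X})=\tan\frac{\pi}{2n}$ when $n$ is even.
   Context: All Banach spaces are real. For a Banach space $\mathbb{X}$, $B_{\mathbb{X}}$ and $S_{\mathbb{X}}$ are its closed unit ball and unit sphere, $\mathbb{X}^*$ is the dual space, and $L(\mathbb{X})$ is the space of bounded linear operators on $\mathbb{X}$ with the operator norm. For $T\in L(\mathbb{X})$ the numerical radius is $v(T)=\sup\{|x^*(Tx)|: x\in S_{\mathbb{X}},\ x^*\in S_{\mathbb{X}^*},\ x^*(x)=1\}$, and the numerical index is $n(\mathbb{X})=\inf\{v(T):T\in L(\mathbb{X}),\ \|T\|=1\}$. A finite-dimensional Banach space is polyhedral if its unit ball has only finitely many extreme points (its vertices); the unit ball is then the convex hull of its vertices. *)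

theory Defs
  imports "HOL-Analysis.Analysis"
begin

text \<open>A real Banach space is a type of class \<open>banach\<close>; its dual and its operator space are the types
  \<open>'a \<Rightarrow>\<^sub>L real\<close> and \<open>'a \<Rightarrow>\<^sub>L 'a\<close> of bounded linear maps, normed by the operator norm.\<close>

definition numerical_radius :: "('a::real_normed_vector \<Rightarrow>\<^sub>L 'a) \<Rightarrow> real" where
  "numerical_radius T =
     Sup {\<bar>blinfun_apply f (blinfun_apply T x)\<bar> | x (f :: 'a \<Rightarrow>\<^sub>L real).
            x \<in> sphere 0 1 \<and> f \<in> sphere 0 1 \<and> blinfun_apply f x = 1}"

definition numerical_index :: "'a::real_normed_vector itself \<Rightarrow> real" where
  "numerical_index _ = Inf {numerical_radius T | T :: 'a \<Rightarrow>\<^sub>L 'a. norm T = 1}"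

definition capped_prism_vertices :: "nat \<Rightarrow> (real^3) set" where
  "capped_prism_vertices n =
     {vector [cos ((real j - 1) * pi / real n), sin ((real j - 1) * pi / real n), s] | j s.
        j \<in> {1..2*n} \<and> s \<in> {1, -1}}
     \<union> {vector [0, 0, 2], vector [0, 0, -2]}"

lemma finite_capped_prism_vertices: "finite (capped_prism_vertices n)"
proof -
  let ?f = "\<lambda>(j, s). vector [cos ((real j - 1) * pi / real n), sin ((real j - 1) * pi / real n), s]
    :: real^3"
  have "capped_prism_vertices n \<subseteq> ?f ` ({1..2*n} \<times> {1, -1}) \<union> {vector [0, 0, 2], vector [0, 0, -2]}"
    unfolding capped_prism_vertices_def by force
  then show ?thesis by (rule finite_subset) simp
qed

text \<open>Every listed point is an extreme point of the convex hull, so a space whose unit ball is that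
  hull is polyhedral and has exactly these points as its vertices.\<close>

lemma extreme_point_of_convex_hull_exposed:
  fixes S :: "'a::euclidean_space set"
  assumes "finite S" "v \<in> S" and less: "\<And>w. w \<in> S \<Longrightarrow> w \<noteq> v \<Longrightarrow> a \<bullet> w < a \<bullet> v"
  shows "v extreme_point_of (convex hull S)"
proof -
  have "convex hull (S - {v}) \<subseteq> {w. a \<bullet> w < a \<bullet> v}"
    by (rule hull_minimal) (use less in \<open>auto intro: convex_halfspace_lt\<close>)
  then have "v \<notin> convex hull (S - {v})" by auto
  then show ?thesis
    using extreme_point_of_convex_hull_insert[of "S - {v}" v] assms by (simp add: insert_absorb)
qed

lemma cos_eq_1_imp_same_direction:
  fixes a b :: real
  assumes "cos (a - b) = 1"
  shows "cos a = cos b \<and> sin a = sin b"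
proof -
  have "(cos a - cos b)\<^sup>2 + (sin a - sin b)\<^sup>2 = 2 - 2 * cos (a - b)"
    using sin_cos_squared_add[of a] sin_cos_squared_add[of b]
    by (simp add: cos_diff power2_eq_square algebra_simps)
  then show ?thesis using assms by (simp add: sum_power2_eq_zero_iff)
qed

lemma extreme_points_capped_prism:
  "{v. v extreme_point_of (convex hull (capped_prism_vertices n))} = capped_prism_vertices n"
proof (intro equalityI subsetI CollectI)
  fix v assume "v \<in> {v. v extreme_point_of (convex hull (capped_prism_vertices n))}"
  then show "v \<in> capped_prism_vertices n" by (auto dest: extreme_point_of_convex_hull)
next
  fix v assume v: "v \<in> capped_prism_vertices n"
  let ?p = "\<lambda>t s. vector [cos t, sin t, s] :: real^3"
  have cases: "(\<exists>t s. w = ?p t s \<and> s \<in> {1, -1}) \<or> w = vector [0, 0, 2] \<or> w = vector [0, 0, -2]"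
    if "w \<in> capped_prism_vertices n" for w
    using that unfolding capped_prism_vertices_def by blast
  have "\<exists>a. \<forall>w \<in> capped_prism_vertices n. w \<noteq> v \<longrightarrow> a \<bullet> w < a \<bullet> v"
    using cases[OF v]
  proof (elim disjE exE conjE)
    fix t s :: real assume t: "v = ?p t s" and s: "s \<in> {1, -1}"
    show ?thesis
    proof (intro exI[of _ "vector [cos t, sin t, s / 2]"] ballI impI)
      fix w assume w: "w \<in> capped_prism_vertices n" "w \<noteq> v"
      have 1: "vector [cos t, sin t, s / 2] \<bullet> v = 3 / 2"
        using s sin_cos_squared_add[of t] by (auto simp: t inner_vec_def sum_3 power2_eq_square)
      have "vector [cos t, sin t, s / 2] \<bullet> w < 3 / 2"
        using cases[OF w(1)]
      proof (elim disjE exE conjE)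
        fix t' s' :: real assume t': "w = ?p t' s'" and s': "s' \<in> {1, -1}"
        have e: "vector [cos t, sin t, s / 2] \<bullet> w = cos (t - t') + s * s' / 2"
          by (simp add: t' inner_vec_def sum_3 cos_diff)
        show ?thesis
        proof (cases "s = s'")
          case True
          then have "cos (t - t') \<noteq> 1"
            using w(2) t t' cos_eq_1_imp_same_direction[of t t'] by auto
          then have "cos (t - t') < 1" using cos_le_one[of "t - t'"] by linarith
          then show ?thesis using e s True by auto
        next
          case False
          then have "s * s' = -1" using s s' by auto
          moreover have "cos (t - t') < 2" by (rule le_less_trans[OF cos_le_one]) simp
          ultimately show ?thesis using e by simp
        qed
      qed (use s in \<open>auto simp: inner_vec_def sum_3\<close>)
      then show "vector [cos t, sin t, s / 2] \<bullet> w < vector [cos t, sin t, s / 2] \<bullet> v"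
        using 1 by simp
    qed
  next
    assume v2: "v = vector [0, 0, 2]"
    show ?thesis
    proof (intro exI[of _ "vector [0, 0, 1]"] ballI impI)
      fix w assume "w \<in> capped_prism_vertices n" "w \<noteq> v"
      then show "vector [0, 0, 1] \<bullet> w < vector [0, 0, 1] \<bullet> v"
        using cases[of w] v2 by (auto simp: inner_vec_def sum_3)
    qed
  next
    assume v2: "v = vector [0, 0, -2]"
    show ?thesis
    proof (intro exI[of _ "vector [0, 0, -1]"] ballI impI)
      fix w assume "w \<in> capped_prism_vertices n" "w \<noteq> v"
      then show "vector [0, 0, -1] \<bullet> w < vector [0, 0, -1] \<bullet> v"
        using cases[of w] v2 by (auto simp: inner_vec_def sum_3)
    qed
  qed
  then show "v extreme_point_of (convex hull (capped_prism_vertices n))"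
    using extreme_point_of_convex_hull_exposed[OF finite_capped_prism_vertices v] by blast
qed

end

theory Submission
  imports Defs
begin

text \<open>
  Write \<open>P\<close> for the norm of the plane whose unit ball is the regular \<open>2n\<close>-gon. The polyhedron of the
  theorem is the unit ball of \<open>max (P w) ((P w + \<bar>z\<bar>) / 2)\<close> at \<open>(w, z)\<close>: its facets are the vertical
  walls over the edges of the polygon and, over each edge, one roof panel through each apex. The
  numerical index turns out to be that of the polygonal plane.

  Upper bound (\<open>extremal_operator\<close>). Rotate the horizontal component by a right angle and forget the
  vertical one. For even \<open>n\<close> the rotation permutes the corners of the polygon; for odd \<open>n\<close> it takes
  corners to multiples of edge midpoints by \<open>1 / cos (pi / 2n)\<close>, and scaling by \<open>cos (pi / 2n)\<close>
  restores norm one. A functional that attains its norm at a vertex cannot be larger at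
  the neighbouring vertices, and this bounds its value on the rotated vertex by the tangent of
  \<open>pi / 2n\<close> (\<open>supporting_turn_le\<close>), times the scaling factor. Other points of the
  unit sphere reduce to vertices, because a functional supporting a convex combination supports
  each of its members (\<open>abs_le_on_face\<close>).

  Lower bound (\<open>norm_le_numerical_radius\<close>). Let \<open>K\<close> be the numerical radius of \<open>T\<close>, let \<open>m\<close> be the
  claimed index, and take a vertex above or below the corner \<open>v\<close>. The two walls and two roof panels
  at this vertex give four functionals whose values on the image under \<open>T\<close> are at most \<open>K\<close>. Split
  the image into a component \<open>\<alpha>\<close> along \<open>v\<close>, a component \<open>\<gamma>\<close> along the direction orthogonal to \<open>v\<close>
  and a height \<open>h\<close>, and put \<open>\<beta> = \<gamma> tan (pi / 2n)\<close>; the four conditions read \<open>\<bar>\<alpha>\<bar> + \<bar>\<beta>\<bar> \<le> K\<close> and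
  \<open>\<bar>\<alpha> \<plusminus> h\<bar> + \<bar>\<beta>\<bar> \<le> 2 K\<close>, with the sign of the vertex. The norm of the image is at most the larger of
  \<open>Q\<close> and \<open>(Q + \<bar>h\<bar>) / 2\<close> with \<open>Q = \<bar>\<alpha>\<bar> + \<bar>\<beta>\<bar> / m\<close>, and since \<open>m \<le> 1 / 2\<close> for \<open>n \<ge> 3\<close>, this is at
  most \<open>K / m\<close> (\<open>norm_image_ring_le\<close>). At an apex all the roof panels of its side are available, and
  they give the bound \<open>2 K \<le> K / m\<close> (\<open>norm_image_apex_le\<close>).

  Norms are estimated from above by writing points through vertices (\<open>norm_cap_le\<close>), while lower
  estimates come from functionals that are bounded by one on the vertices (\<open>numerical_radius_ge\<close>).
\<close>

section \<open>Trigonometry of the regular polygon\<close>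

text \<open>
  An odd multiple of \<open>pi / 2n\<close> lies, modulo \<open>pi\<close>, at distance at least \<open>pi / 2n\<close> from the multiples
  of \<open>pi\<close>. This is why the edge normals of the polygon are bounded by their value at the
  adjacent corners.
\<close>

lemma cos_odd_multiple_le:
  fixes l :: int
  assumes "n > 0"
  shows "\<bar>cos ((2 * of_int l + 1) * pi / (2 * real n))\<bar> \<le> cos (pi / (2 * real n))"
proof -
  define r where "r = l mod int n"
  define q where "q = l div int n"
  have r: "0 \<le> r" "r + 1 \<le> int n" and l: "l = int n * q + r"
    unfolding r_def q_def
    using assms pos_mod_bound[of "int n" l] pos_mod_sign[of "int n" l]
      mult_div_mod_eq[of "int n" l, symmetric]
    by linarith+
  define x where "x = (2 * of_int r + 1) * pi / (2 * real n)"
  have r': "0 \<le> real_of_int r" "real_of_int r + 1 \<le> real n"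
    using r by (simp, metis of_int_le_iff of_int_add of_int_1 of_int_of_nat_eq)
  have "(2 * of_int l + 1) * pi / (2 * real n) = x + of_int q * pi"
    using assms by (simp add: l x_def field_simps)
  moreover have "\<bar>cos (x + of_int q * pi)\<bar> = \<bar>cos x\<bar>"
    using cos_npi_int[of q] by (simp add: cos_add abs_mult mult.commute[of _ pi])
  moreover have "pi / (2 * real n) \<le> x"
    using r' assms by (simp add: x_def field_simps)
  moreover have "x \<le> pi - pi / (2 * real n)"
  proof -
    have "x + pi / (2 * real n) = (of_int r + 1) * (pi / real n)"
      using assms by (simp add: x_def field_simps)
    also have "\<dots> \<le> real n * (pi / real n)"
      using r' by (intro mult_right_mono) auto
    finally show ?thesis using assms by simp
  qed
  moreover have "cos x \<le> cos (pi / (2 * real n))" "- cos x \<le> cos (pi / (2 * real n))"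
    if x: "pi / (2 * real n) \<le> x" "x \<le> pi - pi / (2 * real n)"
  proof -
    have p: "0 < pi / (2 * real n)" using assms by simp
    show "cos x \<le> cos (pi / (2 * real n))"
      by (rule cos_monotone_0_pi_le) (use x p in auto)
    have "cos (pi - x) \<le> cos (pi / (2 * real n))"
      by (rule cos_monotone_0_pi_le) (use x p in auto)
    then show "- cos x \<le> cos (pi / (2 * real n))" by simp
  qed
  ultimately show ?thesis by (simp add: abs_le_iff)
qed

definition polygon_index :: "nat \<Rightarrow> real" where
  "polygon_index n = (if odd n then sin (pi / (2 * real n)) else tan (pi / (2 * real n)))"

text \<open>
  The factor by which a corner of the polygon, rotated by a right angle, must be shrunk to land on
  the boundary of the polygon: a corner again for even \<open>n\<close>, the midpoint of an edge for odd \<open>n\<close>.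
\<close>

definition turn_scale :: "nat \<Rightarrow> real" where
  "turn_scale n = (if odd n then cos (pi / (2 * real n)) else 1)"

lemma half_angle_bounds:
  assumes "n \<ge> 3"
  shows "0 < pi / (2 * real n)" "pi / (2 * real n) \<le> pi / 6"
    "0 < sin (pi / (2 * real n))" "0 < cos (pi / (2 * real n))" "0 < tan (pi / (2 * real n))"
proof -
  show 1: "0 < pi / (2 * real n)" using assms by simp
  show 2: "pi / (2 * real n) \<le> pi / 6" using assms by (simp add: field_simps)
  have 3: "pi / (2 * real n) < pi / 2" using 2 pi_gt_zero by linarith
  show "0 < sin (pi / (2 * real n))" using 1 3 by (intro sin_gt_zero2)
  show "0 < cos (pi / (2 * real n))" using 1 3 by (intro cos_gt_zero)
  show "0 < tan (pi / (2 * real n))" using 1 3 by (intro tan_gt_zero)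
qed

lemma polygon_index_eq:
  assumes "n \<ge> 3"
  shows "polygon_index n = turn_scale n * tan (pi / (2 * real n))"
  using half_angle_bounds(4)[OF assms]
  by (simp add: polygon_index_def turn_scale_def tan_def)

lemma turn_scale_pos: "n \<ge> 3 \<Longrightarrow> 0 < turn_scale n"
  using half_angle_bounds(4) by (simp add: turn_scale_def)

lemma polygon_index_pos: "n \<ge> 3 \<Longrightarrow> 0 < polygon_index n"
  using half_angle_bounds by (simp add: polygon_index_def)

text \<open>
  Equality holds for the hexagon. With index \<open>m\<close> and numerical radius \<open>K\<close>, the bound
  gives \<open>2 K \<le> K / m\<close>, which absorbs the contributions of the roof panels and of the apexes.
\<close>

lemma polygon_index_le_half:
  assumes "n \<ge> 3"
  shows "polygon_index n \<le> 1 / 2"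
proof (cases "odd n")
  case True
  have "sin (pi / (2 * real n)) \<le> sin (pi / 6)"
    by (rule sin_monotone_2pi_le) (use half_angle_bounds[OF assms] in auto)
  then show ?thesis using True by (simp add: polygon_index_def sin_30)
next
  case False
  then have n: "n \<ge> 4" using assms by (cases "n = 3") auto
  have "tan (pi / (2 * real n)) \<le> tan (pi / 8)"
  proof (rule tan_mono_le)
    show "- (pi / 2) < pi / (2 * real n)"
      using half_angle_bounds(1)[OF assms] pi_gt_zero by linarith
    show "pi / (2 * real n) \<le> pi / 8" using n by (simp add: field_simps)
  qed simp
  also have "tan (pi / 8) = sin (pi / 4) / (cos (pi / 4) + 1)"
    using tan_half[of "pi / 8"] by simp
  also have "\<dots> \<le> 1 / 2"
  proof -
    have "sqrt 2 \<le> 2" by (rule real_le_lsqrt) auto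
    moreover have "0 < 2 + sqrt 2" by (simp add: add_pos_nonneg)
    ultimately show ?thesis by (simp add: sin_45 cos_45 field_simps)
  qed
  finally show ?thesis using False by (simp add: polygon_index_def)
qed

text \<open>
  Two consecutive corners of the polygon span an angular sector, and these sectors cover the plane.
\<close>

lemma polygon_sector:
  fixes x y :: real
  assumes "n \<ge> 3"
  obtains k :: int and \<alpha> \<gamma> where "0 \<le> \<alpha>" "0 \<le> \<gamma>"
    "x = \<alpha> * cos (of_int k * pi / real n) + \<gamma> * cos (of_int (k + 1) * pi / real n)"
    "y = \<alpha> * sin (of_int k * pi / real n) + \<gamma> * sin (of_int (k + 1) * pi / real n)"
proof -
  obtain r t where r: "0 \<le> r" and xy: "x = r * cos t" "y = r * sin t"
    using rcis_cmod_Arg[of "Complex x y"] by (metis complex.sel norm_ge_zero Re_rcis Im_rcis)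
  define d where "d = pi / real n"
  have d: "0 < d" "d < pi" using assms by (auto simp: d_def field_simps)
  define k where "k = \<lfloor>t / d\<rfloor>"
  define e where "e = t - of_int k * d"
  \<comment> \<open>\<open>e\<close> is the angle past corner \<open>k\<close>; the coefficients come from the law of sines.\<close>
  have "of_int k \<le> t / d" "t / d < of_int k + 1" by (simp_all add: k_def)
  then have e: "0 \<le> e" "e \<le> d" using d(1) by (simp_all add: e_def field_simps)
  have s: "0 < sin d" using d by (rule sin_gt_zero)
  have t: "t = of_int k * d + e" by (simp add: e_def)
  have a: "of_int k * pi / real n = of_int k * d" "of_int (k + 1) * pi / real n = of_int k * d + d"
    by (simp_all add: d_def add_divide_distrib distrib_right)
  show thesis
  proof (rule that[of "r * sin (d - e) / sin d" "r * sin e / sin d" k])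
    show "0 \<le> r * sin (d - e) / sin d" "0 \<le> r * sin e / sin d"
      using r s d e by (auto intro!: divide_nonneg_pos mult_nonneg_nonneg sin_ge_zero)
    show "x = r * sin (d - e) / sin d * cos (of_int k * pi / real n) +
        r * sin e / sin d * cos (of_int (k + 1) * pi / real n)"
      "y = r * sin (d - e) / sin d * sin (of_int k * pi / real n) +
        r * sin e / sin d * sin (of_int (k + 1) * pi / real n)"
      unfolding a xy t cos_add sin_add sin_diff using s by (simp_all add: field_simps)
  qed
qed

section \<open>Vertices and facets\<close>

text \<open>
  Cylindrical coordinates: the vertices of the prism differ only in the angle and in the sign of the
  height, and rotations act by adding to the angle.
\<close>

definition cyl :: "real \<Rightarrow> real \<Rightarrow> real \<Rightarrow> real^3" where
  "cyl r t z = vector [r * cos t, r * sin t, z]"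

lemma cyl_nth [simp]: "cyl r t z $ 1 = r * cos t" "cyl r t z $ 2 = r * sin t" "cyl r t z $ 3 = z"
  by (simp_all add: cyl_def)

lemma capped_prism_vertices_eq:
  assumes "n > 0"
  shows "capped_prism_vertices n =
    {cyl 1 (of_int k * pi / real n) s | k s. s \<in> {1, -1}} \<union> {cyl 0 0 2, cyl 0 0 (-2)}"
proof -
  have 1: "\<exists>k::int. vector [cos ((real j - 1) * pi / real n), sin ((real j - 1) * pi / real n), s]
      = cyl 1 (of_int k * pi / real n) s" for j s
    by (rule exI[of _ "int j - 1"]) (simp add: cyl_def)
  have 2: "\<exists>j\<in>{1..2*n}. cyl 1 (of_int k * pi / real n) s =
      vector [cos ((real j - 1) * pi / real n), sin ((real j - 1) * pi / real n), s]" for k s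
  proof -
    define r where "r = k mod (2 * int n)"
    define q where "q = k div (2 * int n)"
    have r: "0 \<le> r" "r < 2 * int n" and k: "k = 2 * int n * q + r"
      using assms by (auto simp: r_def q_def)
    have e: "of_int k * pi / real n = of_int r * pi / real n + 2 * pi * of_int q"
      using assms by (simp add: k field_simps)
    have "cyl 1 (of_int k * pi / real n) s = cyl 1 (of_int r * pi / real n) s"
      unfolding e by (simp add: cyl_def sin_add cos_add)
    moreover have "real (nat r + 1) - 1 = of_int r" using r by simp
    ultimately show ?thesis
      using r by (intro bexI[of _ "nat r + 1"]) (auto simp: cyl_def)
  qed
  have 3: "vector [0, 0, 2] = cyl 0 0 2" "vector [0, 0, -2] = cyl 0 0 (-2)"
    by (simp_all add: cyl_def)
  show ?thesis
    unfolding capped_prism_vertices_def 3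
  proof (intro arg_cong2[where f = "(\<union>)"] refl equalityI subsetI)
    fix p :: "real^3" assume "p \<in> {vector [cos ((real j - 1) * pi / real n),
      sin ((real j - 1) * pi / real n), s] | j s. j \<in> {1..2*n} \<and> s \<in> {1, -1}}"
    then show "p \<in> {cyl 1 (of_int k * pi / real n) s | k s. s \<in> {1, -1}}"
      using 1 by blast
  next
    fix p :: "real^3" assume "p \<in> {cyl 1 (of_int k * pi / real n) s | k s. s \<in> {1, -1}}"
    then show "p \<in> {vector [cos ((real j - 1) * pi / real n),
      sin ((real j - 1) * pi / real n), s] | j s. j \<in> {1..2*n} \<and> s \<in> {1, -1}}"
      using 2 by blast
  qed
qed

text \<open>
  The functional that equals one on the vertical wall over the edge from corner \<open>l\<close> to corner
  \<open>l + 1\<close>. On horizontal vectors, the maximum of these functionals is the polygonal norm.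
\<close>

definition side :: "nat \<Rightarrow> int \<Rightarrow> real^3 \<Rightarrow> real" where
  "side n l p = (let a = (2 * of_int l + 1) * pi / (2 * real n)
     in (cos a * p $ 1 + sin a * p $ 2) / cos (pi / (2 * real n)))"

lemma linear_side: "linear (side n l)"
  by (rule linearI) (simp_all add: side_def Let_def add_divide_distrib algebra_simps)

lemma side_cyl:
  "side n l (cyl r t z) = r * cos ((2 * of_int l + 1) * pi / (2 * real n) - t) / cos (pi / (2 * real n))"
  by (simp add: side_def Let_def cos_diff algebra_simps)

lemma abs_side_vertex_le:
  assumes "n \<ge> 3"
  shows "\<bar>side n l (cyl 1 (of_int k * pi / real n) z)\<bar> \<le> 1"
proof -
  have "(2 * of_int l + 1) * pi / (2 * real n) - of_int k * pi / real n
      = (2 * of_int (l - k) + 1) * pi / (2 * real n)"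
    using assms by (simp add: field_simps)
  then show ?thesis
    using cos_odd_multiple_le[of n "l - k"] half_angle_bounds(4)[OF assms] assms
    by (simp add: side_cyl abs_divide)
qed

lemma side_adjacent:
  assumes "n \<ge> 3"
  shows "side n k (cyl 1 (of_int k * pi / real n) z) = 1"
    "side n (k - 1) (cyl 1 (of_int k * pi / real n) z) = 1"
proof -
  have "(2 * of_int k + 1) * pi / (2 * real n) - of_int k * pi / real n = pi / (2 * real n)"
    "(2 * of_int (k - 1) + 1) * pi / (2 * real n) - of_int k * pi / real n = - (pi / (2 * real n))"
    using assms by (simp_all add: field_simps)
  then show "side n k (cyl 1 (of_int k * pi / real n) z) = 1"
    "side n (k - 1) (cyl 1 (of_int k * pi / real n) z) = 1"
    using half_angle_bounds(4)[OF assms] by (simp_all only: side_cyl) auto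
qed

text \<open>
  In the orthonormal frame given by a corner and its rotation by a right angle, the two adjacent
  edge normals are \<open>(1, \<plusminus> tan (pi / 2n))\<close>.
\<close>

lemma side_adjacent_eq:
  fixes k :: int and p :: "real^3"
  assumes "n \<ge> 3"
  defines "t \<equiv> of_int k * pi / real n"
  defines "b \<equiv> tan (pi / (2 * real n)) * (cos t * p $ 2 - sin t * p $ 1)"
  shows "side n k p = cos t * p $ 1 + sin t * p $ 2 + b"
    "side n (k - 1) p = cos t * p $ 1 + sin t * p $ 2 - b"
proof -
  have "(2 * of_int k + 1) * pi / (2 * real n) = t + pi / (2 * real n)"
    "(2 * of_int (k - 1) + 1) * pi / (2 * real n) = t - pi / (2 * real n)"
    using assms(1) by (simp_all add: t_def field_simps)
  then have *: "side n k p = (cos (t + pi / (2 * real n)) * p $ 1 + sin (t + pi / (2 * real n)) * p $ 2)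
      / cos (pi / (2 * real n))"
    "side n (k - 1) p = (cos (t - pi / (2 * real n)) * p $ 1 + sin (t - pi / (2 * real n)) * p $ 2)
      / cos (pi / (2 * real n))"
    by (simp_all only: side_def Let_def)
  define c s where "c = cos (pi / (2 * real n))" and "s = sin (pi / (2 * real n))"
  have "c > 0" using half_angle_bounds(4)[OF assms(1)] by (simp add: c_def)
  then show "side n k p = cos t * p $ 1 + sin t * p $ 2 + b"
    "side n (k - 1) p = cos t * p $ 1 + sin t * p $ 2 - b"
    unfolding * b_def tan_def cos_add cos_diff sin_add sin_diff c_def[symmetric] s_def[symmetric]
    by (simp_all add: field_simps)
qed

text \<open>
  The functional that equals one on the roof panel that joins edge \<open>l\<close> of the top (\<open>s = 1\<close>) or the
  bottom (\<open>s = -1\<close>) polygon to the apex of its side.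
\<close>

definition roof :: "nat \<Rightarrow> int \<Rightarrow> real \<Rightarrow> real^3 \<Rightarrow> real" where
  "roof n l s p = (side n l p + s * p $ 3) / 2"

lemma linear_roof: "linear (roof n l s)"
  by (rule linearI)
     (simp_all add: roof_def linear_add[OF linear_side] linear_scale[OF linear_side] algebra_simps
        add_divide_distrib)

lemma side_add_n:
  assumes "n > 0"
  shows "side n (l + int n) p = - side n l p"
proof -
  have *: "(2 * of_int (l + int n) + 1) * pi / (2 * real n) = (2 * of_int l + 1) * pi / (2 * real n) + pi"
    using assms by (simp add: field_simps)
  show ?thesis unfolding side_def Let_def *
    by (simp add: add_divide_distrib diff_divide_distrib)
qed

section \<open>Faces of a polytope\<close>

text \<open>
  If a functional attains at a convex combination the maximum that it has over the given points,
  then it attains it at each point of positive weight. So an estimate on the points of the face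
  passes to the combination.
\<close>

lemma abs_le_on_face:
  fixes a g :: "'b::real_vector \<Rightarrow> real"
  assumes "finite S" "p \<in> convex hull S" "linear a" "linear g" "a p = 1"
    and le: "\<And>v. v \<in> S \<Longrightarrow> a v \<le> 1"
    and face: "\<And>v. v \<in> S \<Longrightarrow> a v = 1 \<Longrightarrow> \<bar>g v\<bar> \<le> m"
  shows "\<bar>g p\<bar> \<le> m"
proof -
  obtain u where u: "\<And>v. v \<in> S \<Longrightarrow> 0 \<le> u v" "sum u S = 1" and p: "p = (\<Sum>v\<in>S. u v *\<^sub>R v)"
    using assms(1,2) by (auto simp: convex_hull_finite)
  have lin: "h p = (\<Sum>v\<in>S. u v * h v)" if "linear h" for h :: "'b \<Rightarrow> real"
    using that by (simp add: p linear_sum linear_scale)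
  have "(\<Sum>v\<in>S. u v * (1 - a v)) = 0"
    using lin[OF assms(3)] assms(5) u(2) by (simp add: algebra_simps sum_subtractf)
  then have zero: "u v * (1 - a v) = 0" if "v \<in> S" for v
    using that u(1) le assms(1) by (subst (asm) sum_nonneg_eq_0_iff) auto
  have "\<bar>g p\<bar> \<le> (\<Sum>v\<in>S. \<bar>u v * g v\<bar>)"
    unfolding lin[OF assms(4)] by (rule sum_abs)
  also have "\<dots> \<le> (\<Sum>v\<in>S. u v * m)"
  proof (rule sum_mono)
    fix v assume v: "v \<in> S"
    then consider "u v = 0" | "a v = 1" using zero by fastforce
    then show "\<bar>u v * g v\<bar> \<le> u v * m"
      using u(1)[OF v] face[OF v] by cases (auto simp: abs_mult intro!: mult_left_mono)
  qed
  also have "\<dots> = m" by (simp add: u(2) flip: sum_distrib_right)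
  finally show ?thesis .
qed

section \<open>The normed space with the capped prism as unit ball\<close>

locale capped_prism_ball =
  fixes n :: nat and \<phi> :: "real^3 \<Rightarrow> 'a::real_normed_vector"
  assumes n_ge_3: "n \<ge> 3"
    and linear_\<phi>: "linear \<phi>" and bij_\<phi>: "bij \<phi>"
    and ball_eq: "cball 0 1 = \<phi> ` (convex hull (capped_prism_vertices n))"
begin

abbreviation \<psi> :: "'a \<Rightarrow> real^3" where "\<psi> \<equiv> inv \<phi>"

abbreviation vert :: "int \<Rightarrow> real \<Rightarrow> real^3" where
  "vert k s \<equiv> cyl 1 (of_int k * pi / real n) s"

lemma \<psi>_\<phi> [simp]: "\<psi> (\<phi> p) = p" and \<phi>_\<psi> [simp]: "\<phi> (\<psi> x) = x"
  using bij_\<phi> by (simp_all add: bij_is_inj bij_is_surj surj_f_inv_f)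

lemmas \<phi>_simps = linear_add[OF linear_\<phi>] linear_scale[OF linear_\<phi>] linear_0[OF linear_\<phi>]

lemma linear_\<psi>: "linear \<psi>"
proof (rule linearI)
  fix x y :: 'a and r :: real
  have "\<psi> (\<phi> (\<psi> x + \<psi> y)) = \<psi> (x + y)" "\<psi> (\<phi> (r *\<^sub>R \<psi> x)) = \<psi> (r *\<^sub>R x)"
    by (simp_all only: \<phi>_simps \<phi>_\<psi>)
  then show "\<psi> (x + y) = \<psi> x + \<psi> y" "\<psi> (r *\<^sub>R x) = r *\<^sub>R \<psi> x"
    by (simp_all only: \<psi>_\<phi>)
qed

lemma vertex_cases:
  assumes "v \<in> capped_prism_vertices n"
  obtains (ring) k s where "v = vert k s" "s \<in> {1, -1}"
  | (apex) s where "v = cyl 0 0 (2 * s)" "s \<in> {1, -1}"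
proof -
  have "(\<exists>k s. v = vert k s \<and> s \<in> {1, -1}) \<or> v = cyl 0 0 (2 * 1) \<or> v = cyl 0 0 (2 * -1)"
    using assms n_ge_3 capped_prism_vertices_eq[of n] by auto
  then show thesis using that by blast
qed

lemma vertices [intro]:
  "s \<in> {1, -1} \<Longrightarrow> vert k s \<in> capped_prism_vertices n"
  "s \<in> {1, -1} \<Longrightarrow> cyl 0 0 (2 * s) \<in> capped_prism_vertices n"
  using n_ge_3 by (auto simp: capped_prism_vertices_eq)

lemma norm_hull_le_1: "p \<in> convex hull (capped_prism_vertices n) \<Longrightarrow> norm (\<phi> p) \<le> 1"
  using ball_eq by (metis image_eqI mem_cball_0)

lemma hull_of_norm_le_1: "norm x \<le> 1 \<Longrightarrow> \<psi> x \<in> convex hull (capped_prism_vertices n)"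
  using ball_eq by (metis \<psi>_\<phi> imageE mem_cball_0)

text \<open>
  A linear map is bounded on the polyhedron by its bound on the vertices. This also yields the
  continuity of every linear map defined through coordinates.
\<close>

lemma linear_bound_from_vertices:
  fixes g :: "real^3 \<Rightarrow> 'b::real_normed_vector"
  assumes g: "linear g" and le: "\<And>v. v \<in> capped_prism_vertices n \<Longrightarrow> norm (g v) \<le> K"
  shows "norm (g (\<psi> x)) \<le> K * norm x"
proof (cases "x = 0")
  case True
  then show ?thesis using linear_0[OF g] linear_0[OF linear_\<psi>] by simp
next
  case False
  have "convex {p. norm (g p) \<le> K}"
    using convex_linear_vimage[OF g convex_cball[of 0 K]] by (simp add: vimage_def)
  then have hull: "convex hull (capped_prism_vertices n) \<subseteq> {p. norm (g p) \<le> K}"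
    using le by (intro hull_minimal) auto
  have "norm (g (\<psi> (x /\<^sub>R norm x))) \<le> K"
    using hull hull_of_norm_le_1[of "x /\<^sub>R norm x"] False by auto
  then show ?thesis
    using False by (simp add: linear_scale[OF linear_\<psi>] linear_scale[OF g] field_simps)
qed

lemma bounded_linear_pullback:
  fixes g :: "real^3 \<Rightarrow> 'b::real_normed_vector"
  assumes g: "linear g" and le: "\<And>v. v \<in> capped_prism_vertices n \<Longrightarrow> norm (g v) \<le> K"
  shows "bounded_linear (\<lambda>x. g (\<psi> x))"
proof (rule bounded_linear_intro)
  show "norm (g (\<psi> x)) \<le> norm x * K" for x
    using linear_bound_from_vertices[OF g le] by (simp add: mult.commute)
qed (simp_all add: linear_add[OF g] linear_scale[OF g] linear_add[OF linear_\<psi>] linear_scale[OF linear_\<psi>])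

text \<open>
  The ball contains the vertical segments from height \<open>-1\<close> to height \<open>1\<close> over two horizontal vectors.
  The multiples of these segments by \<open>\<alpha>\<close> and \<open>\<gamma>\<close> have norm at most \<open>\<bar>\<alpha>\<bar>\<close> and \<open>\<bar>\<gamma>\<bar>\<close>, so their sum
  reaches every height up to \<open>Q = \<bar>\<alpha>\<bar> + \<bar>\<gamma>\<bar>\<close> within norm \<open>Q\<close>. Height in excess of \<open>Q\<close> comes from the
  apex, which has height two, and costs one half per unit.
\<close>

lemma norm_cap_le:
  assumes v: "\<And>s. s \<in> {1, -1} \<Longrightarrow> norm (\<phi> (cyl r t s)) \<le> 1"
    and w: "\<And>s. s \<in> {1, -1} \<Longrightarrow> norm (\<phi> (cyl r' t' s)) \<le> 1"
    and p: "p = \<alpha> *\<^sub>R cyl r t 0 + \<gamma> *\<^sub>R cyl r' t' 0 + cyl 0 0 h"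
  shows "norm (\<phi> p) \<le> max (\<bar>\<alpha>\<bar> + \<bar>\<gamma>\<bar>) ((\<bar>\<alpha>\<bar> + \<bar>\<gamma>\<bar> + \<bar>h\<bar>) / 2)"
proof -
  have wall: "norm (\<phi> (a *\<^sub>R cyl r t 0 + cyl 0 0 (\<theta> * \<bar>a\<bar>))) \<le> \<bar>a\<bar>"
    if u: "\<And>s. s \<in> {1, -1} \<Longrightarrow> norm (\<phi> (cyl r t s)) \<le> 1" and \<theta>: "\<bar>\<theta>\<bar> \<le> 1" for r t \<theta> a
  proof -
    \<comment> \<open>A negative factor turns the segment over, so the sign of \<open>a\<close> moves into the height.\<close>
    define \<theta>' where "\<theta>' = sgn a * \<theta>"
    have \<theta>': "\<bar>\<theta>'\<bar> \<le> 1" using \<theta> by (auto simp: \<theta>'_def abs_mult sgn_if)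
    have "cyl r t \<theta>' = ((1 + \<theta>') / 2) *\<^sub>R cyl r t 1 + ((1 - \<theta>') / 2) *\<^sub>R cyl r t (-1)"
      by (simp add: vec_eq_iff forall_3 field_simps)
    then have "\<phi> (cyl r t \<theta>') = ((1 + \<theta>') / 2) *\<^sub>R \<phi> (cyl r t 1) + ((1 - \<theta>') / 2) *\<^sub>R \<phi> (cyl r t (-1))"
      by (simp add: \<phi>_simps)
    also have "norm \<dots> \<le> (1 + \<theta>') / 2 * norm (\<phi> (cyl r t 1)) + (1 - \<theta>') / 2 * norm (\<phi> (cyl r t (-1)))"
      using \<theta>' by (intro order_trans[OF norm_triangle_ineq]) (auto simp: abs_le_iff)
    also have "\<dots> \<le> (1 + \<theta>') / 2 * 1 + (1 - \<theta>') / 2 * 1"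
      using \<theta>' u[of 1] u[of "-1"] by (intro add_mono mult_left_mono) (auto simp: abs_le_iff)
    finally have "norm (\<phi> (cyl r t \<theta>')) \<le> 1" by (simp add: field_simps)
    moreover have "a *\<^sub>R cyl r t 0 + cyl 0 0 (\<theta> * \<bar>a\<bar>) = a *\<^sub>R cyl r t \<theta>'"
      by (simp add: vec_eq_iff forall_3 \<theta>'_def abs_sgn[of a])
    ultimately show ?thesis
      by (simp add: \<phi>_simps mult_left_le)
  qed
  have axis: "norm (\<phi> (cyl 0 0 a)) \<le> \<bar>a\<bar> / 2" for a
  proof -
    have "norm (\<phi> (cyl 0 0 2)) \<le> 1"
      using norm_hull_le_1[OF hull_inc[OF vertices(2)[of 1]]] by simp
    moreover have "cyl 0 0 a = (a / 2) *\<^sub>R cyl 0 0 2" by (simp add: vec_eq_iff forall_3)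
    ultimately show ?thesis by (simp add: \<phi>_simps mult_left_le)
  qed
  define Q where "Q = \<bar>\<alpha>\<bar> + \<bar>\<gamma>\<bar>"
  have split: "norm (\<phi> p) \<le> Q + \<bar>h - \<theta> * Q\<bar> / 2" if "\<bar>\<theta>\<bar> \<le> 1" for \<theta>
  proof -
    have "p = (\<alpha> *\<^sub>R cyl r t 0 + cyl 0 0 (\<theta> * \<bar>\<alpha>\<bar>)) + (\<gamma> *\<^sub>R cyl r' t' 0 + cyl 0 0 (\<theta> * \<bar>\<gamma>\<bar>))
        + cyl 0 0 (h - \<theta> * Q)"
      by (simp add: p vec_eq_iff forall_3 Q_def algebra_simps)
    then have "norm (\<phi> p) \<le> norm (\<phi> (\<alpha> *\<^sub>R cyl r t 0 + cyl 0 0 (\<theta> * \<bar>\<alpha>\<bar>)))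
        + norm (\<phi> (\<gamma> *\<^sub>R cyl r' t' 0 + cyl 0 0 (\<theta> * \<bar>\<gamma>\<bar>))) + norm (\<phi> (cyl 0 0 (h - \<theta> * Q)))"
      by (metis (no_types, lifting) linear_add[OF linear_\<phi>] norm_triangle_mono norm_triangle_ineq order_refl)
    also have "\<dots> \<le> \<bar>\<alpha>\<bar> + \<bar>\<gamma>\<bar> + \<bar>h - \<theta> * Q\<bar> / 2"
      using wall[OF v that, of \<alpha>] wall[OF w that, of \<gamma>] axis by (intro add_mono) auto
    finally show ?thesis by (simp add: Q_def)
  qed
  show ?thesis
  proof (cases "\<bar>h\<bar> \<le> Q")
    case True
    have "\<bar>h / Q\<bar> \<le> 1" "h / Q * Q = h"
      using True by (auto simp: divide_le_eq abs_divide)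
    then have "norm (\<phi> p) \<le> Q" using split[of "h / Q"] by simp
    then show ?thesis by (simp add: Q_def)
  next
    case False
    moreover have "0 \<le> Q" by (simp add: Q_def)
    ultimately have "\<bar>h - sgn h * Q\<bar> = \<bar>h\<bar> - Q" by (auto simp: sgn_if abs_if)
    then have "norm (\<phi> p) \<le> (Q + \<bar>h\<bar>) / 2"
      using split[of "sgn h"] by (simp add: abs_sgn_eq field_simps)
    then show ?thesis by (simp add: Q_def le_max_iff_disj)
  qed
qed

text \<open>
  A functional that is bounded by one on the vertices has norm at most one, so reaching the value
  one at a vertex forces both the functional and the vertex to be of norm one.
\<close>

lemma supporting_functional:
  assumes a: "linear a" and le: "\<And>v. v \<in> capped_prism_vertices n \<Longrightarrow> \<bar>a v\<bar> \<le> 1"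
    and v: "v \<in> capped_prism_vertices n" "a v = 1"
  obtains f :: "'a \<Rightarrow>\<^sub>L real"
  where "\<And>x. f x = a (\<psi> x)" "norm f = 1" "norm (\<phi> v) = 1" "f (\<phi> v) = 1"
proof -
  define f where "f = Blinfun (\<lambda>x. a (\<psi> x))"
  have f: "blinfun_apply f x = a (\<psi> x)" for x
    unfolding f_def using bounded_linear_pullback[OF a, of 1] le
    by (simp add: bounded_linear_Blinfun_apply)
  have f1: "norm f \<le> 1"
    by (rule norm_blinfun_bound) (use linear_bound_from_vertices[OF a, of 1] le in \<open>auto simp: f\<close>)
  have v1: "norm (\<phi> v) \<le> 1" using norm_hull_le_1[OF hull_inc[OF v(1)]] .
  have fv: "f (\<phi> v) = 1" by (simp add: f v)
  then have ge: "1 \<le> norm f * norm (\<phi> v)" using norm_blinfun[of f "\<phi> v"] by simp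
  have "norm f = 1" "norm (\<phi> v) = 1"
    using ge f1 v1 mult_left_le[of "norm (\<phi> v)" "norm f"] mult_left_le_one_le[of "norm (\<phi> v)" "norm f"]
    by (auto intro!: antisym)
  then show thesis using that f fv by blast
qed

lemma numerical_radius_ge:
  fixes T :: "'a \<Rightarrow>\<^sub>L 'a"
  assumes a: "linear a" and le: "\<And>v. v \<in> capped_prism_vertices n \<Longrightarrow> \<bar>a v\<bar> \<le> 1"
    and v: "v \<in> capped_prism_vertices n" "a v = 1"
  shows "\<bar>a (\<psi> (T (\<phi> v)))\<bar> \<le> numerical_radius T"
proof -
  obtain f :: "'a \<Rightarrow>\<^sub>L real"
    where f: "\<And>x. f x = a (\<psi> x)" "norm f = 1" "norm (\<phi> v) = 1" "f (\<phi> v) = 1"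
    using supporting_functional[OF a le v] by blast
  have mem: "\<bar>f (T (\<phi> v))\<bar> \<in> {\<bar>blinfun_apply f (blinfun_apply T x)\<bar> | x (f :: 'a \<Rightarrow>\<^sub>L real).
            x \<in> sphere 0 1 \<and> f \<in> sphere 0 1 \<and> blinfun_apply f x = 1}" (is "_ \<in> ?S")
    by (rule CollectI, rule exI[of _ "\<phi> v"], rule exI[of _ f]) (use f v in simp)
  have "bdd_above ?S"
  proof (rule bdd_aboveI[of _ "norm T"], clarify)
    fix x :: 'a and f :: "'a \<Rightarrow>\<^sub>L real" assume "x \<in> sphere 0 1" "f \<in> sphere 0 1"
    then show "\<bar>f (T x)\<bar> \<le> norm T"
      using norm_blinfun[of f "T x"] norm_blinfun[of T x] by simp
  qed
  then show ?thesis
    unfolding numerical_radius_def using cSup_upper[OF mem] by (simp add: f)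
qed

section \<open>Lower bound for the numerical radius\<close>

lemma norm_ring_le: "s \<in> {1, -1} \<Longrightarrow> norm (\<phi> (vert k s)) \<le> 1"
  by (intro norm_hull_le_1 hull_inc vertices)

text \<open>
  The rotated and scaled corner is a corner for even \<open>n\<close>. For odd \<open>n\<close> it is the midpoint of the two
  corners at angular distance \<open>pi / 2n\<close> from it.
\<close>

lemma norm_turned_ring_le:
  assumes "s \<in> {1, -1}"
  shows "norm (\<phi> (cyl (turn_scale n) (of_int k * pi / real n + pi / 2) s)) \<le> 1"
proof (cases "odd n")
  case False
  then obtain m where m: "n = 2 * m" by auto
  have "of_int k * pi / real n + pi / 2 = of_int (k + int m) * pi / real n"
    using n_ge_3 by (simp add: m field_simps)
  then show ?thesis using norm_ring_le[OF assms, of "k + int m"] False by (simp add: turn_scale_def)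
next
  case True
  then obtain m where m: "n = 2 * m + 1" by (auto elim: oddE)
  define t where "t = of_int k * pi / real n + pi / 2"
  define h where "h = pi / (2 * real n)"
  have half: "of_int (k + int m) = of_int k + (real n - 1) / 2"
    "of_int (k + int m + 1) = of_int k + (real n + 1) / 2"
    by (simp_all add: m)
  have "of_int (k + int m) * pi / real n = t - h" "of_int (k + int m + 1) * pi / real n = t + h"
    unfolding half using n_ge_3 by (simp_all add: t_def h_def field_simps)
  then have *: "vert (k + int m) s = cyl 1 (t - h) s" "vert (k + int m + 1) s = cyl 1 (t + h) s"
    by (simp_all only:)
  have "cyl (turn_scale n) t s = (1 / 2) *\<^sub>R vert (k + int m) s + (1 / 2) *\<^sub>R vert (k + int m + 1) s"
    unfolding * using True
    by (simp add: vec_eq_iff forall_3 turn_scale_def flip: h_def)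
       (simp add: cos_add cos_diff sin_add sin_diff add_divide_distrib diff_divide_distrib algebra_simps)
  then have "norm (\<phi> (cyl (turn_scale n) t s)) \<le>
      norm ((1 / 2) *\<^sub>R \<phi> (vert (k + int m) s)) + norm ((1 / 2) *\<^sub>R \<phi> (vert (k + int m + 1) s))"
    by (simp only: \<phi>_simps norm_triangle_ineq)
  then show ?thesis
    using norm_ring_le[OF assms, of "k + int m"] norm_ring_le[OF assms, of "k + int m + 1"]
    by (simp add: t_def)
qed

lemma abs_side_le:
  assumes "v \<in> capped_prism_vertices n"
  shows "\<bar>side n l v\<bar> \<le> 1"
  using assms by (cases rule: vertex_cases) (use n_ge_3 abs_side_vertex_le in \<open>auto simp: side_cyl[of _ _ 0]\<close>)

lemma abs_roof_le:
  assumes "v \<in> capped_prism_vertices n" "s \<in> {1, -1}"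
  shows "\<bar>roof n l s v\<bar> \<le> 1"
  using assms(1)
proof (cases rule: vertex_cases)
  case (ring k s')
  then show ?thesis
    using abs_side_vertex_le[OF n_ge_3, of l k s'] assms(2) by (auto simp: roof_def abs_le_iff)
next
  case (apex s')
  then show ?thesis using assms(2) by (auto simp: roof_def side_cyl)
qed

text \<open>
  The facets at a vertex already control the norm of its image: the region cut out in the plane by
  the two adjacent walls is a parallelogram, and its corners are \<open>\<plusminus>v\<close> and two points orthogonal to
  \<open>v\<close>, of polygonal norm exactly \<open>1 / m\<close> for the index \<open>m\<close>. The roof panels bound the height in terms
  of the same two components.
\<close>

lemma norm_image_ring_le:
  fixes T :: "'a \<Rightarrow>\<^sub>L 'a"
  assumes s: "s \<in> {1, -1}"
  shows "norm (T (\<phi> (vert k s))) \<le> numerical_radius T / polygon_index n"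
proof -
  define K where "K = numerical_radius T"
  define y where "y = \<psi> (T (\<phi> (vert k s)))"
  define t where "t = of_int k * pi / real n"
  define \<alpha> where "\<alpha> = cos t * y $ 1 + sin t * y $ 2"
  define \<gamma> where "\<gamma> = cos t * y $ 2 - sin t * y $ 1"
  define \<beta> where "\<beta> = tan (pi / (2 * real n)) * \<gamma>"
  define h where "h = y $ 3"
  have side_y: "side n k y = \<alpha> + \<beta>" "side n (k - 1) y = \<alpha> - \<beta>"
    using side_adjacent_eq[OF n_ge_3, of k y] by (simp_all add: \<alpha>_def \<beta>_def \<gamma>_def t_def)
  have side_le: "\<bar>side n l y\<bar> \<le> K" if "l \<in> {k, k - 1}" for l
    using numerical_radius_ge[OF linear_side abs_side_le vertices(1)[OF s], of l k T]
      side_adjacent[OF n_ge_3, of k s] that by (auto simp: y_def K_def)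
  have roof_le: "\<bar>roof n l s y\<bar> \<le> K" if "l \<in> {k, k - 1}" for l
    using numerical_radius_ge[OF linear_roof abs_roof_le[OF _ s] vertices(1)[OF s], of l k T]
      side_adjacent[OF n_ge_3, of k s] that s by (auto simp: y_def K_def roof_def)
  \<comment> \<open>The larger modulus of \<open>\<alpha> + \<beta>\<close> and \<open>\<alpha> - \<beta>\<close> is \<open>\<bar>\<alpha>\<bar> + \<bar>\<beta>\<bar>\<close>.\<close>
  have 1: "\<bar>\<alpha>\<bar> + \<bar>\<beta>\<bar> \<le> K"
    using side_le[of k] side_le[of "k - 1"] by (simp add: side_y)
  have 2: "\<bar>\<alpha> + s * h\<bar> + \<bar>\<beta>\<bar> \<le> 2 * K"
    using roof_le[of k] roof_le[of "k - 1"] by (simp add: roof_def side_y h_def)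
  have "\<bar>h\<bar> = \<bar>s * h\<bar>" using s by auto
  then have 3: "\<bar>h\<bar> \<le> 2 * K - \<bar>\<beta>\<bar> + \<bar>\<alpha>\<bar>" using 2 by linarith
  define M where "M = 1 / polygon_index n"
  have M: "2 \<le> M"
    using polygon_index_pos[OF n_ge_3] polygon_index_le_half[OF n_ge_3]
    by (simp add: M_def le_divide_eq)
  have \<lambda>: "0 < turn_scale n" using turn_scale_pos[OF n_ge_3] .
  have "norm (\<phi> y) \<le> max (\<bar>\<alpha>\<bar> + \<bar>\<gamma> / turn_scale n\<bar>) ((\<bar>\<alpha>\<bar> + \<bar>\<gamma> / turn_scale n\<bar> + \<bar>h\<bar>) / 2)"
  proof (rule norm_cap_le[of 1 t "turn_scale n" "t + pi / 2"])
    show "norm (\<phi> (cyl 1 t s)) \<le> 1" if "s \<in> {1, -1}" for s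
      using norm_ring_le[OF that, of k] by (simp add: t_def)
    show "norm (\<phi> (cyl (turn_scale n) (t + pi / 2) s)) \<le> 1" if "s \<in> {1, -1}" for s
      using norm_turned_ring_le[OF that, of k] by (simp add: t_def)
    have "\<alpha> * cos t - \<gamma> * sin t = ((sin t)\<^sup>2 + (cos t)\<^sup>2) * y $ 1"
      "\<alpha> * sin t + \<gamma> * cos t = ((sin t)\<^sup>2 + (cos t)\<^sup>2) * y $ 2"
      by (simp_all only: \<alpha>_def \<gamma>_def)
         (simp_all add: algebra_simps power2_eq_square del: sin_cos_squared_add3)
    then have "y $ 1 = \<alpha> * cos t - \<gamma> * sin t" "y $ 2 = \<alpha> * sin t + \<gamma> * cos t"
      by simp_all
    then show "y = \<alpha> *\<^sub>R cyl 1 t 0 + (\<gamma> / turn_scale n) *\<^sub>R cyl (turn_scale n) (t + pi / 2) 0 + cyl 0 0 h"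
      using \<lambda> by (simp add: vec_eq_iff forall_3 h_def sin_add cos_add)
  qed
  also have "\<bar>\<gamma> / turn_scale n\<bar> = M * \<bar>\<beta>\<bar>"
    using \<lambda> half_angle_bounds(5)[OF n_ge_3]
    by (simp add: M_def \<beta>_def polygon_index_eq[OF n_ge_3] abs_mult abs_divide)
  finally have "norm (\<phi> y) \<le> max (\<bar>\<alpha>\<bar> + M * \<bar>\<beta>\<bar>) ((\<bar>\<alpha>\<bar> + M * \<bar>\<beta>\<bar> + \<bar>h\<bar>) / 2)" .
  also have "\<dots> \<le> M * K"
  proof -
    have "M * (\<bar>\<alpha>\<bar> + \<bar>\<beta>\<bar>) \<le> M * K" "2 * \<bar>\<alpha>\<bar> \<le> M * \<bar>\<alpha>\<bar>" "2 * K \<le> M * K"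
      using M 1 by (auto intro!: mult_left_mono mult_right_mono)
    moreover have "0 \<le> \<bar>\<alpha>\<bar>" "0 \<le> \<bar>\<beta>\<bar>" by simp_all
    ultimately have "\<bar>\<alpha>\<bar> + M * \<bar>\<beta>\<bar> \<le> M * K" "\<bar>\<alpha>\<bar> + M * \<bar>\<beta>\<bar> + \<bar>h\<bar> \<le> 2 * (M * K)"
      using 3 unfolding distrib_left by linarith+
    then show ?thesis by simp
  qed
  finally show ?thesis by (simp add: y_def M_def K_def)
qed

text \<open>
  All roof panels of one side meet at the apex, in opposite pairs. So the numerical radius bounds the
  sum of the height and the full polygonal norm of the image, which is read off from the wall over
  the sector that contains the horizontal part of the image.
\<close>

lemma norm_image_apex_le:
  fixes T :: "'a \<Rightarrow>\<^sub>L 'a"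
  assumes s: "s \<in> {1, -1}"
  shows "norm (T (\<phi> (cyl 0 0 (2 * s)))) \<le> 2 * numerical_radius T"
proof -
  define K where "K = numerical_radius T"
  define y where "y = \<psi> (T (\<phi> (cyl 0 0 (2 * s))))"
  obtain k \<alpha> \<gamma> where nonneg: "0 \<le> \<alpha>" "0 \<le> \<gamma>" and
    y: "y $ 1 = \<alpha> * cos (of_int k * pi / real n) + \<gamma> * cos (of_int (k + 1) * pi / real n)"
      "y $ 2 = \<alpha> * sin (of_int k * pi / real n) + \<gamma> * sin (of_int (k + 1) * pi / real n)"
    using polygon_sector[OF n_ge_3, of "y $ 1" "y $ 2"] by metis
  have y_eq: "y = \<alpha> *\<^sub>R vert k 0 + \<gamma> *\<^sub>R vert (k + 1) 0 + cyl 0 0 (y $ 3)"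
    by (simp add: vec_eq_iff forall_3 y)
  have "side n k y = \<alpha> * side n k (vert k 0) + \<gamma> * side n k (vert (k + 1) 0) + side n k (cyl 0 0 (y $ 3))"
    by (subst y_eq) (simp only: linear_add[OF linear_side] linear_scale[OF linear_side] real_scaleR_def)
  then have side_y: "side n k y = \<alpha> + \<gamma>"
    using side_adjacent(1)[OF n_ge_3, of k 0] side_adjacent(2)[OF n_ge_3, of "k + 1" 0]
    by (simp add: side_cyl[of _ _ 0])
  have roof_le: "\<bar>roof n l s y\<bar> \<le> K" for l
    using numerical_radius_ge[OF linear_roof abs_roof_le[OF _ s] vertices(2)[OF s], of l T] s
    by (auto simp: y_def K_def roof_def side_cyl)
  have "n > 0" using n_ge_3 by simp
  then have "\<bar>\<alpha> + \<gamma> + s * y $ 3\<bar> \<le> 2 * K" "\<bar>- (\<alpha> + \<gamma>) + s * y $ 3\<bar> \<le> 2 * K"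
    using roof_le[of k] roof_le[of "k + int n"] by (simp_all add: roof_def side_y side_add_n)
  moreover have "\<bar>y $ 3\<bar> = \<bar>s * y $ 3\<bar>" using s by auto
  ultimately have "\<alpha> + \<gamma> + \<bar>y $ 3\<bar> \<le> 2 * K" using nonneg by linarith
  moreover have "norm (\<phi> y) \<le> max (\<bar>\<alpha>\<bar> + \<bar>\<gamma>\<bar>) ((\<bar>\<alpha>\<bar> + \<bar>\<gamma>\<bar> + \<bar>y $ 3\<bar>) / 2)"
    by (rule norm_cap_le[OF _ _ y_eq]) (rule norm_ring_le, assumption)+
  ultimately have "norm (\<phi> y) \<le> 2 * K" using nonneg by (auto simp: max_def split: if_splits)
  then show ?thesis by (simp add: y_def K_def)
qed

lemma norm_le_numerical_radius:
  fixes T :: "'a \<Rightarrow>\<^sub>L 'a"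
  shows "norm T \<le> numerical_radius T / polygon_index n"
proof -
  have ring: "norm (T (\<phi> (vert k s))) \<le> numerical_radius T / polygon_index n" if "s \<in> {1, -1}" for k s
    using norm_image_ring_le[OF that] .
  have pos: "0 < polygon_index n" using polygon_index_pos[OF n_ge_3] .
  have nonneg: "0 \<le> numerical_radius T / polygon_index n"
    using ring[of 1 0] by (intro order_trans[OF norm_ge_zero]) auto
  then have "0 \<le> numerical_radius T" using pos by (simp add: zero_le_divide_iff)
  then have "numerical_radius T * (2 * polygon_index n) \<le> numerical_radius T * 1"
    using polygon_index_le_half[OF n_ge_3] by (intro mult_left_mono) auto
  then have two: "2 * numerical_radius T \<le> numerical_radius T / polygon_index n"
    using pos by (simp add: le_divide_eq algebra_simps)
  have lin: "linear (\<lambda>p. T (\<phi> p))"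
    by (rule linearI) (simp_all add: \<phi>_simps blinfun.bilinear_simps)
  have vertex: "norm (T (\<phi> v)) \<le> numerical_radius T / polygon_index n" if "v \<in> capped_prism_vertices n" for v
    using that
  proof (cases rule: vertex_cases)
    case (ring k s)
    then show ?thesis using norm_image_ring_le by simp
  next
    case (apex s)
    then show ?thesis using norm_image_apex_le[of s T] two by simp
  qed
  show ?thesis
    using linear_bound_from_vertices[OF lin vertex] nonneg by (intro norm_blinfun_bound) auto
qed

section \<open>The extremal operator\<close>

definition turn :: "real^3 \<Rightarrow> real^3" where
  "turn p = turn_scale n *\<^sub>R vector [- (p $ 2), p $ 1, 0]"

lemma turn_cyl: "turn (cyl r t z) = cyl (turn_scale n * r) (t + pi / 2) 0"
  by (simp add: turn_def vec_eq_iff forall_3 cos_add sin_add)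

lemma linear_turn: "linear turn"
  by (rule linearI) (simp_all add: turn_def vec_eq_iff forall_3 algebra_simps)

lemma norm_turn_vertex_le:
  assumes "v \<in> capped_prism_vertices n"
  shows "norm (\<phi> (turn v)) \<le> 1"
  using assms
proof (cases rule: vertex_cases)
  case (ring k s)
  let ?w = "cyl (turn_scale n) (of_int k * pi / real n + pi / 2) 0"
  have "norm (\<phi> ?w) \<le> max (\<bar>1\<bar> + \<bar>0\<bar>) ((\<bar>1\<bar> + \<bar>0\<bar> + \<bar>0\<bar>) / 2)"
    by (rule norm_cap_le[OF norm_turned_ring_le[of _ k] norm_turned_ring_le[of _ k]])
       (auto simp: vec_eq_iff forall_3)
  then show ?thesis by (simp add: ring turn_cyl)
next
  case (apex s)
  have "turn v = 0" by (simp add: apex turn_cyl vec_eq_iff forall_3)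
  then show ?thesis by (simp add: \<phi>_simps)
qed

text \<open>
  The functional attains its maximum at \<open>v\<close>, so its horizontal part does not increase towards the two
  neighbouring corners. This bounds the component \<open>R\<close> orthogonal to \<open>v\<close> by \<open>A tan (pi / 2n)\<close> for the
  component \<open>A\<close> along \<open>v\<close>. The bound \<open>A \<le> 1\<close> comes from the vertex on the other end of the vertical
  edge through \<open>v\<close>.
\<close>

lemma supporting_turn_le:
  assumes a: "linear a" and le: "\<And>v. v \<in> capped_prism_vertices n \<Longrightarrow> \<bar>a v\<bar> \<le> 1"
    and v: "v \<in> capped_prism_vertices n" "a v = 1"
  shows "\<bar>a (turn v)\<bar> \<le> polygon_index n"
  using v(1)
proof (cases rule: vertex_cases)
  case (apex s)
  have "turn v = 0" by (simp add: apex turn_cyl vec_eq_iff forall_3)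
  then show ?thesis using polygon_index_pos[OF n_ge_3] linear_0[OF a] by simp
next
  case (ring k s)
  define t where "t = of_int k * pi / real n"
  define h where "h = pi / (2 * real n)"
  define A R Z where "A = a (cyl 1 t 0)" and "R = a (cyl 1 (t + pi / 2) 0)" and "Z = a (cyl 0 0 s)"
  have vert: "a (cyl 1 (t + e) z) = cos e * A + sin e * R + a (cyl 0 0 z)" for e z
  proof -
    have "cyl 1 (t + e) z = cos e *\<^sub>R cyl 1 t 0 + sin e *\<^sub>R cyl 1 (t + pi / 2) 0 + cyl 0 0 z"
      by (simp add: vec_eq_iff forall_3 cos_add sin_add)
    then show ?thesis by (simp add: linear_add[OF a] linear_scale[OF a] A_def R_def)
  qed
  have neg: "a (cyl 0 0 (- s)) = - Z"
  proof -
    have "cyl 0 0 (- s) = - cyl 0 0 s" by (simp add: vec_eq_iff forall_3)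
    then show ?thesis by (simp add: linear_neg[OF a] Z_def)
  qed
  have AZ: "A + Z = 1" using vert[of 0 s] v(2) ring by (simp add: t_def Z_def)
  have "\<bar>A - Z\<bar> \<le> 1"
    using vert[of 0 "- s"] le[OF vertices(1)[of "- s" k]] ring(2) by (auto simp: neg t_def)
  then have A: "A \<le> 1" "0 \<le> A" using AZ by linarith+
  have next_vert: "cos (2 * h) * A + sin (2 * h) * R + Z \<le> 1" "cos (2 * h) * A - sin (2 * h) * R + Z \<le> 1"
  proof -
    have e: "of_int (k + 1) * pi / real n = t + 2 * h" "of_int (k - 1) * pi / real n = t + - (2 * h)"
      using n_ge_3 by (simp_all add: t_def h_def field_simps)
    show "cos (2 * h) * A + sin (2 * h) * R + Z \<le> 1"
      using le[OF vertices(1)[OF ring(2), of "k + 1"]] unfolding e vert by (simp add: Z_def)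
    show "cos (2 * h) * A - sin (2 * h) * R + Z \<le> 1"
      using le[OF vertices(1)[OF ring(2), of "k - 1"]] unfolding e vert by (simp add: Z_def)
  qed
  have pos: "0 < sin h" "0 < cos h" "0 < sin (2 * h)"
    using half_angle_bounds[OF n_ge_3] by (simp_all add: h_def[symmetric] sin_double)
  have "sin (2 * h) * \<bar>R\<bar> \<le> (1 - cos (2 * h)) * A"
    using next_vert AZ by (auto simp: abs_if algebra_simps)
  also have "\<dots> \<le> (1 - cos (2 * h)) * 1"
    using A by (intro mult_left_mono) auto
  also have "\<dots> = sin (2 * h) * tan h"
    using pos by (simp add: cos_double_sin sin_double tan_def power2_eq_square)
  finally have "\<bar>R\<bar> \<le> tan h" using pos by simp
  moreover have "a (turn v) = turn_scale n * R"
  proof -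
    have "turn v = turn_scale n *\<^sub>R cyl 1 (t + pi / 2) 0"
      by (simp add: ring turn_cyl t_def vec_eq_iff forall_3)
    then show ?thesis by (simp add: linear_scale[OF a] R_def)
  qed
  ultimately show ?thesis
    using turn_scale_pos[OF n_ge_3] by (simp add: polygon_index_eq[OF n_ge_3] abs_mult h_def)
qed

text \<open>
  A functional of norm one that certifies that the rotated first corner has norm one: the wall over
  the edge that contains it.
\<close>

lemma side_turn_vertex: "side n (int (n div 2)) (turn (vert 0 1)) = 1"
proof (cases "odd n")
  case True
  then obtain m where m: "n = 2 * m + 1" by (auto elim: oddE)
  then have "2 * real (n div 2) + 1 = real n" by simp
  then show ?thesis
    using True n_ge_3 half_angle_bounds(4)[OF n_ge_3] by (simp add: turn_cyl side_cyl turn_scale_def)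
next
  case False
  then obtain m where m: "n = 2 * m" by auto
  have "(2 * of_int (int (n div 2)) + 1) * pi / (2 * real n) - pi / 2 = pi / (2 * real n)"
    using n_ge_3 by (simp add: m field_simps)
  then show ?thesis
    using False half_angle_bounds(4)[OF n_ge_3] by (simp add: turn_cyl side_cyl turn_scale_def)
qed

lemma extremal_operator:
  obtains T :: "'a \<Rightarrow>\<^sub>L 'a" where "norm T = 1" "numerical_radius T \<le> polygon_index n"
proof
  define T where "T = Blinfun (\<lambda>x. \<phi> (turn (\<psi> x)))"
  have lin: "linear (\<lambda>p. \<phi> (turn p))"
    using linear_compose[OF linear_turn linear_\<phi>] by (simp add: o_def)
  have T: "blinfun_apply T x = \<phi> (turn (\<psi> x))" for x
    unfolding T_def using bounded_linear_pullback[OF lin norm_turn_vertex_le]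
    by (simp add: bounded_linear_Blinfun_apply)
  have le: "norm T \<le> 1"
    using linear_bound_from_vertices[OF lin norm_turn_vertex_le] by (intro norm_blinfun_bound) (auto simp: T)
  have "1 = norm (side n (int (n div 2)) (\<psi> (T (\<phi> (vert 0 1)))))"
    by (simp add: T side_turn_vertex del: of_int_0)
  also have "\<dots> \<le> 1 * norm (T (\<phi> (vert 0 1)))"
    using abs_side_le by (intro linear_bound_from_vertices linear_side) auto
  also have "\<dots> \<le> norm T * norm (\<phi> (vert 0 1))" using norm_blinfun by simp
  also have "\<dots> \<le> norm T * 1" using norm_ring_le[of 1 0] by (intro mult_left_mono) auto
  finally show "norm T = 1" using le by simp
  have v0: "vert 0 1 \<in> capped_prism_vertices n" by (rule vertices) simp
  obtain f\<^sub>0 :: "'a \<Rightarrow>\<^sub>L real"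
    where "norm f\<^sub>0 = 1" "norm (\<phi> (vert 0 1)) = 1" "f\<^sub>0 (\<phi> (vert 0 1)) = 1"
    using supporting_functional[OF linear_side abs_side_le v0 side_adjacent(1)[OF n_ge_3, of 0 1]] by blast
  then have nonempty: "\<exists>x (f :: 'a \<Rightarrow>\<^sub>L real). x \<in> sphere 0 1 \<and> f \<in> sphere 0 1 \<and> blinfun_apply f x = 1"
    by (intro exI[of _ "\<phi> (vert 0 1)"] exI[of _ f\<^sub>0]) simp
  show "numerical_radius T \<le> polygon_index n"
    unfolding numerical_radius_def
  proof (rule cSup_least)
    show "{\<bar>blinfun_apply f (blinfun_apply T x)\<bar> | x (f :: 'a \<Rightarrow>\<^sub>L real).
        x \<in> sphere 0 1 \<and> f \<in> sphere 0 1 \<and> blinfun_apply f x = 1} \<noteq> {}"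
      using nonempty by blast
    fix z assume "z \<in> {\<bar>blinfun_apply f (blinfun_apply T x)\<bar> | x (f :: 'a \<Rightarrow>\<^sub>L real).
        x \<in> sphere 0 1 \<and> f \<in> sphere 0 1 \<and> blinfun_apply f x = 1}"
    then obtain x and f :: "'a \<Rightarrow>\<^sub>L real"
      where z: "z = \<bar>f (T x)\<bar>" and x: "norm x = 1" and f: "norm f = 1" "f x = 1" by auto
    have a: "linear (\<lambda>p. f (\<phi> p))"
      by (rule linearI) (simp_all add: \<phi>_simps blinfun.bilinear_simps)
    have av: "\<bar>f (\<phi> v)\<bar> \<le> 1" if "v \<in> capped_prism_vertices n" for v
      using norm_blinfun[of f "\<phi> v"] f norm_hull_le_1[OF hull_inc[OF that]] by simp
    have "\<bar>f (\<phi> (turn (\<psi> x)))\<bar> \<le> polygon_index n"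
    proof (rule abs_le_on_face[where a = "\<lambda>p. f (\<phi> p)" and g = "\<lambda>p. f (\<phi> (turn p))" and p = "\<psi> x",
          OF finite_capped_prism_vertices _ a])
      show "\<psi> x \<in> convex hull (capped_prism_vertices n)" using hull_of_norm_le_1 x by simp
      show "linear (\<lambda>p. f (\<phi> (turn p)))" using linear_compose[OF linear_turn a] by (simp add: o_def)
      show "f (\<phi> (\<psi> x)) = 1" using f by simp
      show "f (\<phi> v) \<le> 1" if "v \<in> capped_prism_vertices n" for v
        using av[OF that] by simp
      show "\<bar>f (\<phi> (turn v))\<bar> \<le> polygon_index n" if "v \<in> capped_prism_vertices n" "f (\<phi> v) = 1" for v
        using supporting_turn_le[OF a av that] by simp
    qed
    then show "z \<le> polygon_index n" by (simp add: z T)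
  qed
qed

lemma numerical_index_eq: "numerical_index TYPE('a) = polygon_index n"
proof -
  have ge: "polygon_index n \<le> numerical_radius T" if "norm T = 1" for T :: "'a \<Rightarrow>\<^sub>L 'a"
    using norm_le_numerical_radius[of T] polygon_index_pos[OF n_ge_3] that by (simp add: le_divide_eq)
  obtain T :: "'a \<Rightarrow>\<^sub>L 'a" where T: "norm T = 1" "numerical_radius T \<le> polygon_index n"
    using extremal_operator by blast
  then have "polygon_index n = numerical_radius T" using ge by (simp add: antisym)
  then show ?thesis
    unfolding numerical_index_def using T(1) ge by (intro cInf_eq_minimum) auto
qed

end

theorem theorem2p9:
  fixes n :: nat
    and \<phi> :: "real^3 \<Rightarrow> 'a::banach"
  assumes "n \<ge> 3"
    and "linear \<phi>" and "bij \<phi>"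
    and "cball 0 1 = \<phi> ` (convex hull (capped_prism_vertices n))"
  shows "(odd n \<longrightarrow> numerical_index TYPE('a) = sin (pi / (2 * real n))) \<and>
         (even n \<longrightarrow> numerical_index TYPE('a) = tan (pi / (2 * real n)))"
proof -
  interpret capped_prism_ball n \<phi>
    using assms by (rule capped_prism_ball.intro)
  show ?thesis
    by (simp add: numerical_index_eq polygon_index_def)
qed

end
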